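(* Let $X$ be an infinite-dimensional separable $F$-space, and let $\Lambda$ be a countable collection of continuous linear operators on $X$. Suppose that for each $T\in\Lambda$ there exist a continuous linear operator $h_T:X\to X$ and a strictly increasing sequence $(\theta_{n,T})_n$ of positive integers such that $$\{x\in X:\lim_{n\to\infty}T^{\theta_{n,T}}x=h_Tx\}$$ is dense in $X$. Then there exists a dense vector subspace $E$ of $X$ and, for each $T\in\Lambda$, a strictly increasing sequence $(k_{n,T})_n$ of positive integers such that $$E\subset\{x\in X:\lim_{n\to\infty}T^{k_{n,T}}x=h_Tx\}\quad\text{for all }T\in\Lambda.$$
   Context: An $F$-space is a completely metrizable topological vector space. *)

theory Defs
  imports "HOL-Analysis.Analysis"
begin

text \<open>
  The scalars range over \<^class>\<open>real_normed_field\<close>, so that real and complex spaces are treated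
  uniformly; up to isomorphism (Gelfand--Mazur) this class has no instances other than the real
  and the complex numbers. Continuity of vector addition is part of
  \<^class>\<open>topological_ab_group_add\<close>; Hausdorffness follows from metrizability.
\<close>

locale F_space = vector_space scale
  for scale :: "'k::real_normed_field \<Rightarrow> 'a::topological_ab_group_add \<Rightarrow> 'a" +
  assumes continuous_scale: "continuous_on UNIV (\<lambda>(c, x). scale c x)"
    and completely_metrizable: "completely_metrizable_space (euclidean :: 'a topology)"

definition continuous_operator ::
  "('k::field \<Rightarrow> 'a::{ab_group_add,topological_space} \<Rightarrow> 'a) \<Rightarrow> ('a \<Rightarrow> 'a) \<Rightarrow> bool"
  where "continuous_operator s T \<longleftrightarrow> Vector_Spaces.linear s s T \<and> continuous_on UNIV T"

end

theory Submission
  imports Defs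
begin

text \<open>
  In the completely metrizable space of all sequences in \<open>X\<close>, the dense sequences form a residual
  set, and so do, for each \<open>T\<close>, the sequences \<open>f\<close> such that \<open>T\<^bsup>\<theta> n\<^esup> (f j)\<close> comes simultaneously
  arbitrarily close to \<open>h\<^sub>T (f j)\<close> for \<open>j \<le> m\<close>, for every \<open>m\<close>: the latter set is
  \<open>G\<^sub>\<delta>\<close> and contains every sequence of points at which \<open>T\<^bsup>\<theta> n\<^esup>\<close> converges to \<open>h\<^sub>T\<close>.
  By Baire's theorem some dense sequence has this property for all \<open>T\<close>; passing to a subsequence of \<open>\<theta>\<close> gives
  convergence at all its members, hence on their linear span.
\<close>

section \<open>Baire category and density in product spaces\<close>

lemma Baire_Inter_nonempty:
  fixes \<G> :: "'b::topological_space set set"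
  assumes "completely_metrizable_space (euclidean :: 'b topology)" "countable \<G>"
    and "\<And>G. G \<in> \<G> \<Longrightarrow> open G \<and> closure G = UNIV"
  shows "\<Inter>\<G> \<noteq> {}"
proof -
  have "euclidean closure_of \<Inter>\<G> = topspace (euclidean :: 'b topology)"
    using assms by (intro Baire_category) auto
  then show ?thesis
    by fastforce
qed

lemma completely_metrizable_space_fun:
  assumes "completely_metrizable_space (euclidean :: 'b::topological_space topology)"
  shows "completely_metrizable_space (euclidean :: ('i::countable \<Rightarrow> 'b) topology)"
  unfolding euclidean_product_topology [symmetric]
  using assms by (simp add: completely_metrizable_space_product_topology)

lemma dense_iff_meets_open:
  "closure S = UNIV \<longleftrightarrow> (\<forall>U. open U \<longrightarrow> U \<noteq> {} \<longrightarrow> U \<inter> S \<noteq> {})"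
proof
  assume "closure S = UNIV"
  then show "\<forall>U. open U \<longrightarrow> U \<noteq> {} \<longrightarrow> U \<inter> S \<noteq> {}"
    using open_Int_closure_eq_empty by fastforce
next
  assume "\<forall>U. open U \<longrightarrow> U \<noteq> {} \<longrightarrow> U \<inter> S \<noteq> {}"
  then have "- closure S = {}"
    using closure_subset by (metis Int_commute Compl_disjoint disjoint_eq_subset_Compl
        double_complement open_Compl closed_closure)
  then show "closure S = UNIV"
    by blast
qed

text \<open>Boxes restricting only finitely many coordinates form a base of the product topology, so
  density can be tested on them. The other coordinates may then be chosen freely.\<close>

lemma dense_fun_if_meets_boxes:
  fixes S :: "('i \<Rightarrow> 'b::topological_space) set"
  assumes "\<And>U. (\<And>i. open (U i) \<and> U i \<noteq> {}) \<Longrightarrow> finite {i. U i \<noteq> UNIV} \<Longrightarrow>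
    \<exists>f\<in>S. \<forall>i. f i \<in> U i"
  shows "closure S = UNIV"
  unfolding dense_iff_meets_open
proof (intro allI impI)
  fix W :: "('i \<Rightarrow> 'b) set"
  assume W: "open W" "W \<noteq> {}"
  then obtain w where "w \<in> W"
    by blast
  with W obtain U where U: "w \<in> (\<Pi>\<^sub>E i\<in>UNIV. U i)" "\<And>i. open (U i)"
      "finite {i. U i \<noteq> UNIV}" "(\<Pi>\<^sub>E i\<in>UNIV. U i) \<subseteq> W"
    using product_topology_open_contains_basis [of "\<lambda>_. euclidean" UNIV W w]
    unfolding open_fun_def by auto
  moreover from U(1) have "U i \<noteq> {}" for i
    by auto
  ultimately obtain f where "f \<in> S" "\<forall>i. f i \<in> U i"
    using assms [of U] by blast
  with U(4) show "W \<inter> S \<noteq> {}"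
    by (auto simp: PiE_UNIV_domain)
qed

section \<open>Neighbourhoods of zero and diagonal subsequences\<close>

text \<open>The type carries a topology but no distinguished metric. Balls of radius
  \<open>1 / Suc m\<close> in some compatible metric provide a countable decreasing base, and the
  later arguments use only this base.\<close>

lemma metrizable_nhds_base:
  fixes a :: "'b::topological_space"
  assumes "metrizable_space (euclidean :: 'b topology)"
  obtains V :: "nat \<Rightarrow> 'b set"
  where "\<And>m. open (V m)" "\<And>m. a \<in> V m" "decseq V"
    "\<And>U. open U \<Longrightarrow> a \<in> U \<Longrightarrow> \<exists>m. V m \<subseteq> U"
proof -
  obtain M d where Md: "Metric_space M d" and eq: "(euclidean :: 'b topology) = Metric_space.mtopology M d"
    using assms unfolding metrizable_space_def by blast
  interpret Metric_space M d
    by (rule Md)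
  have M: "M = UNIV"
    using arg_cong [OF eq, of topspace] by simp
  have open_iff: "open U \<longleftrightarrow> openin mtopology U" for U
    by (metis eq open_openin)
  define V where "V m = mball a (1 / real (Suc m))" for m
  show ?thesis
  proof
    show "open (V m)" for m
      by (simp add: V_def open_iff)
    show "a \<in> V m" for m
      unfolding V_def by (subst centre_in_mball_iff) (auto simp: M)
    show "decseq V"
      unfolding V_def decseq_def by (intro allI impI mball_subset_concentric) (simp add: field_simps)
    show "\<exists>m. V m \<subseteq> U" if U: "open U" "a \<in> U" for U
    proof -
      obtain r where r: "r > 0" "mball a r \<subseteq> U"
        using U unfolding open_iff openin_mtopology by blast
      obtain m where "1 / real (Suc m) < r"
        using r(1) by (metis inverse_eq_divide reals_Archimedean)
      then have "V m \<subseteq> mball a r"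
        unfolding V_def by (intro mball_subset_concentric) simp
      with r(2) show ?thesis
        by blast
    qed
  qed
qed

text \<open>Subtraction moves every limit to 0, so a single base at 0 controls convergence to all
  the points \<open>h i (f j)\<close>.\<close>

lemma tendsto_iff_diff_tendsto_zero:
  fixes a :: "'b::topological_ab_group_add"
  shows "(f \<longlongrightarrow> a) F \<longleftrightarrow> ((\<lambda>x. f x - a) \<longlongrightarrow> 0) F"
proof
  assume "(f \<longlongrightarrow> a) F"
  from tendsto_diff [OF this tendsto_const [of a]] show "((\<lambda>x. f x - a) \<longlongrightarrow> 0) F"
    by simp
next
  assume "((\<lambda>x. f x - a) \<longlongrightarrow> 0) F"
  from tendsto_add [OF this tendsto_const [of a]] show "(f \<longlongrightarrow> a) F"
    by simp
qed

lemma subsequence_if_infinitely_often: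
  fixes P :: "nat \<Rightarrow> nat \<Rightarrow> bool"
  assumes ex: "\<And>m. \<exists>n\<ge>m. P m n"
    and anti: "\<And>m m' n. m \<le> m' \<Longrightarrow> P m' n \<Longrightarrow> P m n"
  obtains r where "strict_mono r" "\<And>m. P m (r m)"
proof -
  \<comment> \<open>A witness taken at the index \<open>max (Suc m) (Suc x)\<close> exceeds
    \<open>x\<close>, and it satisfies \<open>P (Suc m)\<close> because \<open>P\<close> weakens as
    its first argument decreases.\<close>
  have "\<exists>y. P (Suc m) y \<and> x < y" for m x
    using ex [of "max (Suc m) (Suc x)"] anti [of "Suc m" "max (Suc m) (Suc x)"]
    by (metis Suc_le_eq max.bounded_iff max.cobounded1)
  then have "\<exists>r. \<forall>m. P m (r m) \<and> r m < r (Suc m)"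
    using ex [of 0] by (intro dependent_nat_choice) blast+
  then show ?thesis
    using that by (metis strict_mono_Suc_iff)
qed

section \<open>A generic sequence of points\<close>

text \<open>In the application \<open>F i n\<close> is a power of an operator. Linearity enters only
  afterwards, when the sequence is replaced by its span.\<close>

lemma dense_sequence_common_convergence:
  fixes F :: "'i \<Rightarrow> nat \<Rightarrow> 'a \<Rightarrow> 'a::topological_ab_group_add"
  assumes cm: "completely_metrizable_space (euclidean :: 'a topology)"
    and sep: "separable_space (euclidean :: 'a topology)"
    and I: "countable I"
    and contF: "\<And>i n. i \<in> I \<Longrightarrow> continuous_on UNIV (F i n)"
    and conth: "\<And>i. i \<in> I \<Longrightarrow> continuous_on UNIV (h i)"
    and dense: "\<And>i. i \<in> I \<Longrightarrow> closure {x. (\<lambda>n. F i n x) \<longlonglongrightarrow> h i x} = UNIV"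
  obtains f :: "nat \<Rightarrow> 'a" where "closure (range f) = UNIV"
    "\<And>i. i \<in> I \<Longrightarrow> \<exists>r. strict_mono r \<and> (\<forall>j. (\<lambda>n. F i (r n) (f j)) \<longlonglongrightarrow> h i (f j))"
proof -
  obtain V :: "nat \<Rightarrow> 'a set" where V: "\<And>m. open (V m)" "\<And>m. 0 \<in> V m" "decseq V"
      "\<And>U. open U \<Longrightarrow> 0 \<in> U \<Longrightarrow> \<exists>m. V m \<subseteq> U"
    using metrizable_nhds_base [OF completely_metrizable_imp_metrizable_space [OF cm], of 0] by blast
  obtain C :: "'a set" where C: "countable C" "closure C = UNIV"
    using sep unfolding separable_space_def by auto
  \<comment> \<open>Lying in \<open>A s m\<close> for all \<open>s\<close> in the dense set
    \<open>C\<close> and all \<open>m\<close> makes the range of \<open>f\<close> dense.\<close>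
  define A :: "'a \<Rightarrow> nat \<Rightarrow> (nat \<Rightarrow> 'a) set" where "A s m = {f. \<exists>j. f j - s \<in> V m}" for s m
  \<comment> \<open>One \<open>n\<close> serves all \<open>j\<close> up to \<open>m\<close>, so that
    a single subsequence will work for every term. Letting \<open>m\<close> govern both the number
    of terms and the neighbourhood makes \<open>P\<close> antitone in \<open>m\<close> and keeps the
    condition on \<open>f\<close> open, as it involves finitely many coordinates.\<close>
  define P where "P i f m n \<longleftrightarrow> (\<forall>j\<le>m. F i n (f j) - h i (f j) \<in> V m)"
    for i m n and f :: "nat \<Rightarrow> 'a"
  define B where "B i m = {f. \<exists>n\<ge>m. P i f m n}" for i m
  have openA: "open (A s m)" for s m
  proof -
    have "open ((\<lambda>f. f j - s) -` V m)" for j :: nat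
      by (intro open_vimage V continuous_intros) auto
    moreover have "A s m = (\<Union>j. (\<lambda>f. f j - s) -` V m)"
      by (auto simp: A_def)
    ultimately show ?thesis
      by auto
  qed
  have openB: "open (B i m)" if "i \<in> I" for i m
  proof -
    have "open ((\<lambda>f. F i n (f j) - h i (f j)) -` V m)" for j n :: nat
      by (intro open_vimage V continuous_on_diff
          continuous_on_compose2 [OF contF [OF that]] continuous_on_compose2 [OF conth [OF that]]) auto
    then have "open (\<Union>n\<in>{m..}. \<Inter>j\<in>{..m}. (\<lambda>f. F i n (f j) - h i (f j)) -` V m)"
      by (intro open_UN ballI open_INT) auto
    also have "(\<Union>n\<in>{m..}. \<Inter>j\<in>{..m}. (\<lambda>f. F i n (f j) - h i (f j)) -` V m) = B i m"
      by (auto simp: B_def P_def)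
    finally show ?thesis .
  qed
  have denseA: "closure (A s m) = UNIV" for s m
  proof (rule dense_fun_if_meets_boxes)
    fix U :: "nat \<Rightarrow> 'a set"
    assume U: "\<And>i. open (U i) \<and> U i \<noteq> {}" "finite {i. U i \<noteq> UNIV}"
    then obtain j where j: "U j = UNIV"
      using ex_new_if_finite [OF infinite_UNIV_nat] by blast
    \<comment> \<open>The unrestricted coordinate \<open>j\<close> is free to take the value
      \<open>s\<close> itself, whose difference from \<open>s\<close> is 0.\<close>
    define f where "f = (\<lambda>i. SOME x. x \<in> U i)(j := s)"
    have "\<forall>i. f i \<in> U i"
      using U(1) j by (auto simp: f_def some_in_eq)
    moreover have "f \<in> A s m"
      using V(2) by (auto simp: A_def f_def intro!: exI [of _ j])
    ultimately show "\<exists>f\<in>A s m. \<forall>i. f i \<in> U i"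
      by blast
  qed
  have denseB: "closure (B i m) = UNIV" if i: "i \<in> I" for i m
  proof (rule dense_fun_if_meets_boxes)
    fix U :: "nat \<Rightarrow> 'a set"
    assume "\<And>i. open (U i) \<and> U i \<noteq> {}"
    \<comment> \<open>Every coordinate, restricted or not, is chosen among the points of
      convergence. The finitely many eventual conditions for \<open>j\<close> up to \<open>m\<close>
      then hold together for all large \<open>n\<close>, in particular for some \<open>n\<close> at
      least \<open>m\<close>.\<close>
    then have "\<exists>x. x \<in> U j \<and> (\<lambda>n. F i n x) \<longlonglongrightarrow> h i x" for j
      using dense [OF i] unfolding dense_iff_meets_open by blast
    then obtain f where f: "\<And>j. f j \<in> U j" "\<And>j. (\<lambda>n. F i n (f j)) \<longlonglongrightarrow> h i (f j)"
      by metis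
    have "\<forall>\<^sub>F n in sequentially. F i n (f j) - h i (f j) \<in> V m" for j
      using f(2) [of j] V(1,2) unfolding tendsto_iff_diff_tendsto_zero [of _ "h i (f j)"]
      by (blast dest: topological_tendstoD)
    then have "\<forall>\<^sub>F n in sequentially. P i f m n"
      unfolding P_def by (simp flip: atMost_iff add: eventually_ball_finite_distrib Ball_def [symmetric])
    then have "f \<in> B i m"
      unfolding B_def using eventually_sequentially by (smt (verit) mem_Collect_eq max.cobounded1 max.cobounded2)
    with f(1) show "\<exists>f\<in>B i m. \<forall>i. f i \<in> U i"
      by blast
  qed
  \<comment> \<open>Countability of \<open>C\<close> and \<open>I\<close> makes this a countable
    family of dense open sets in the sequence space.\<close>
  have "\<Inter>((\<lambda>(s, m). A s m) ` (C \<times> UNIV) \<union> (\<lambda>(i, m). B i m) ` (I \<times> UNIV)) \<noteq> {}"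
    using C(1) I openA openB denseA denseB
    by (intro Baire_Inter_nonempty completely_metrizable_space_fun cm) auto
  then obtain f where f: "\<And>s m. s \<in> C \<Longrightarrow> f \<in> A s m" "\<And>i m. i \<in> I \<Longrightarrow> f \<in> B i m"
    by fastforce
  show ?thesis
  proof
    show "closure (range f) = UNIV"
      unfolding dense_iff_meets_open
    proof (intro allI impI)
      fix U :: "'a set"
      assume U: "open U" "U \<noteq> {}"
      then obtain s where s: "s \<in> C" "s \<in> U"
        using C(2) unfolding dense_iff_meets_open by blast
      \<comment> \<open>Translating by \<open>s\<close> turns \<open>U\<close> into a neighbourhood
        of 0, to which the base \<open>V\<close> applies.\<close>
      have "open ((\<lambda>x. x + s) -` U)"
        by (intro open_vimage U continuous_intros)
      then obtain m where m: "V m \<subseteq> (\<lambda>x. x + s) -` U"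
        using V(4) s(2) by fastforce
      obtain j where "f j - s \<in> V m"
        using f(1) [OF s(1)] by (auto simp: A_def)
      with m have "f j \<in> U"
        by fastforce
      then show "U \<inter> range f \<noteq> {}"
        by blast
    qed
  next
    fix i
    assume i: "i \<in> I"
    have "\<exists>n\<ge>m. P i f m n" for m
      using f(2) [OF i] by (auto simp: B_def)
    moreover have "P i f m n" if "m \<le> m'" "P i f m' n" for m m' n
      using that decseqD [OF V(3)] unfolding P_def by (meson order_trans subset_iff)
    ultimately obtain r where r: "strict_mono r" "\<And>m. P i f m (r m)"
      using subsequence_if_infinitely_often [of "P i f"] by blast
    have "(\<lambda>n. F i (r n) (f j)) \<longlonglongrightarrow> h i (f j)" for j
      unfolding tendsto_iff_diff_tendsto_zero [of _ "h i (f j)"]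
    proof (rule topological_tendstoI)
      fix U :: "'a set"
      assume "open U" "0 \<in> U"
      then obtain m where m: "V m \<subseteq> U"
        using V(4) by blast
      \<comment> \<open>The bound \<open>j\<close> places the term \<open>f j\<close> among those
        controlled by \<open>P i f n (r n)\<close>; the bound \<open>m\<close> gives that
        \<open>V n\<close> lies inside \<open>V m\<close>.\<close>
      have "F i (r n) (f j) - h i (f j) \<in> U" if "n \<ge> max m j" for n
        using r(2) [of n] that m decseqD [OF V(3), of m n] unfolding P_def by auto
      then show "\<forall>\<^sub>F n in sequentially. F i (r n) (f j) - h i (f j) \<in> U"
        unfolding eventually_sequentially by blast
    qed
    with r(1) show "\<exists>r. strict_mono r \<and> (\<forall>j. (\<lambda>n. F i (r n) (f j)) \<longlonglongrightarrow> h i (f j))"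
      by blast
  qed
qed

section \<open>Linear operators and passage to the span\<close>

lemma continuous_operator_funpow:
  fixes scale :: "'k::field \<Rightarrow> 'b::{ab_group_add,topological_space} \<Rightarrow> 'b"
  assumes "vector_space scale" "continuous_operator scale T"
  shows "continuous_operator scale (T ^^ n)"
proof (induction n)
  case 0
  then show ?case
    using vector_space.linear_id [OF assms(1)] by (simp add: continuous_operator_def id_def)
next
  case (Suc n)
  then show ?case
    using assms(2) unfolding continuous_operator_def funpow.simps
    by (auto intro!: Vector_Spaces.linear_compose intro: continuous_on_compose2 [of UNIV T])
qed

text \<open>Limits commute with the continuous vector operations. Convergence at the members of a
  sequence thus extends to all of its span, along the same subsequence.\<close>

lemma (in F_space) subspace_convergence:
  assumes L: "\<And>n. Vector_Spaces.linear scale scale (L n)" and g: "Vector_Spaces.linear scale scale g"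
  shows "subspace {x. (\<lambda>n. L n x) \<longlonglongrightarrow> g x}"
proof -
  note L' = module_hom_linearI [OF L] and g' = module_hom_linearI [OF g]
  show ?thesis
  proof (rule subspaceI)
    show "0 \<in> {x. (\<lambda>n. L n x) \<longlonglongrightarrow> g x}"
      by (simp add: module_hom.zero [OF L'] module_hom.zero [OF g'])
  next
    fix x y
    assume "x \<in> {x. (\<lambda>n. L n x) \<longlonglongrightarrow> g x}" "y \<in> {x. (\<lambda>n. L n x) \<longlonglongrightarrow> g x}"
    then show "x + y \<in> {x. (\<lambda>n. L n x) \<longlonglongrightarrow> g x}"
      using tendsto_add [of "\<lambda>n. L n x" "g x" sequentially "\<lambda>n. L n y" "g y"]
      by (simp add: module_hom.add [OF L'] module_hom.add [OF g'])
  next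
    fix c x
    assume x: "x \<in> {x. (\<lambda>n. L n x) \<longlonglongrightarrow> g x}"
    have "continuous_on UNIV (\<lambda>x. scale c x)"
      using continuous_on_compose2 [OF continuous_scale, of UNIV "\<lambda>x. (c, x)"]
      by (simp add: continuous_on_Pair)
    from continuous_on_tendsto_compose [OF this, of "\<lambda>n. L n x" "g x"] x
    have "(\<lambda>n. scale c (L n x)) \<longlonglongrightarrow> scale c (g x)"
      by simp
    then show "scale c x \<in> {x. (\<lambda>n. L n x) \<longlonglongrightarrow> g x}"
      by (simp add: module_hom.scale [OF L'] module_hom.scale [OF g'])
  qed
qed

theorem proposition4p7:
  fixes scale :: "'k::real_normed_field \<Rightarrow> 'a::topological_ab_group_add \<Rightarrow> 'a"
    and \<Lambda> :: "('a \<Rightarrow> 'a) set"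
    and h :: "('a \<Rightarrow> 'a) \<Rightarrow> 'a \<Rightarrow> 'a"
    and \<theta> :: "('a \<Rightarrow> 'a) \<Rightarrow> nat \<Rightarrow> nat"
  assumes "F_space scale"
    and "\<not> (\<exists>B. finite_dimensional_vector_space scale B)"
    and "separable_space (euclidean :: 'a topology)"
    and "countable \<Lambda>"
    and "\<And>T. T \<in> \<Lambda> \<Longrightarrow> continuous_operator scale T"
    and "\<And>T. T \<in> \<Lambda> \<Longrightarrow> continuous_operator scale (h T)"
    and "\<And>T. T \<in> \<Lambda> \<Longrightarrow> strict_mono (\<theta> T) \<and> (\<forall>n. \<theta> T n > 0)"
    and "\<And>T. T \<in> \<Lambda> \<Longrightarrow> closure {x. (\<lambda>n. (T ^^ \<theta> T n) x) \<longlonglongrightarrow> h T x} = UNIV"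
  shows "\<exists>E k. module.subspace scale E \<and> closure E = UNIV \<and>
           (\<forall>T\<in>\<Lambda>. strict_mono (k T) \<and> (\<forall>n. k T n > (0::nat)) \<and>
              E \<subseteq> {x. (\<lambda>n. (T ^^ k T n) x) \<longlonglongrightarrow> h T x})"
proof -
  interpret F_space scale
    by (rule assms(1))
  have pow: "continuous_operator scale (T ^^ n)" if "T \<in> \<Lambda>" for T n
    using continuous_operator_funpow assms(5) that vector_space_axioms by blast
  obtain f :: "nat \<Rightarrow> 'a" where f: "closure (range f) = UNIV"
    "\<And>T. T \<in> \<Lambda> \<Longrightarrow> \<exists>r. strict_mono r \<and> (\<forall>j. (\<lambda>n. (T ^^ \<theta> T (r n)) (f j)) \<longlonglongrightarrow> h T (f j))"
    using dense_sequence_common_convergence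
        [of \<Lambda> "\<lambda>T n. T ^^ \<theta> T n" h, OF completely_metrizable assms(3,4) _ _ assms(8)]
      pow assms(6) unfolding continuous_operator_def by metis
  then obtain r where r: "\<And>T. T \<in> \<Lambda> \<Longrightarrow> strict_mono (r T)"
    "\<And>T j. T \<in> \<Lambda> \<Longrightarrow> (\<lambda>n. (T ^^ \<theta> T (r T n)) (f j)) \<longlonglongrightarrow> h T (f j)"
    by metis
  show ?thesis
  \<comment> \<open>The witnesses are \<open>span (range f)\<close> for \<open>E\<close> and the
    composition of \<open>\<theta> T\<close> with \<open>r T\<close> for \<open>k T\<close>; they
    remain schematic until the goals below fix them.\<close>
  proof (intro exI conjI ballI allI)
    show "subspace (span (range f))"
      by simp
    show "closure (span (range f)) = UNIV"
      using f(1) closure_mono [OF span_superset [of "range f"]] by auto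
    fix T
    assume T: "T \<in> \<Lambda>"
    show "strict_mono (\<lambda>n. \<theta> T (r T n))"
      using r(1) [OF T] assms(7) [OF T] by (simp add: strict_mono_def)
    show "\<theta> T (r T n) > 0" for n
      using assms(7) [OF T] by blast
    have "subspace {x. (\<lambda>n. (T ^^ \<theta> T (r T n)) x) \<longlonglongrightarrow> h T x}"
      using pow [OF T] assms(6) [OF T] by (intro subspace_convergence) (auto simp: continuous_operator_def)
    then show "span (range f) \<subseteq> {x. (\<lambda>n. (T ^^ \<theta> T (r T n)) x) \<longlonglongrightarrow> h T x}"
      using r(2) [OF T] by (intro span_minimal) auto
  qed
qed

end
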